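(* For every positive integer $n$ there exists a real quadratic field $K$ such that $n$ is properly $K$-congruent.
   Context: Let $K$ be a number field and let $n$ be a positive integer. We say that $n$ is a $K$-congruent number if there exist $a,b,c\in K$ such that $$a^2+b^2=c^2\qquad\text{and}\qquad \tfrac12 ab=n.$$ A $K$-congruent number $n$ is called properly $K$-congruent if this system has infinitely many solutions $(a,b,c)\in K^3$. A real quadratic field is a subfield of $\mathbb{R}$ of degree $2$ over $\mathbb{Q}$. *)

theory Defs
  imports Complex_Main
begin

definition is_subfield :: "'a::field set \<Rightarrow> bool" where
  "is_subfield K \<longleftrightarrow>
     0 \<in> K \<and> 1 \<in> K \<and>
     (\<forall>x\<in>K. \<forall>y\<in>K. x + y \<in> K \<and> x * y \<in> K) \<and>
     (\<forall>x\<in>K. - x \<in> K) \<and>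
     (\<forall>x\<in>K. x \<noteq> 0 \<longrightarrow> inverse x \<in> K)"

global_interpretation rat_vs:
  vector_space "\<lambda>(q::rat) (x::'a::field_char_0). of_rat q * x"
  defines rat_span = rat_vs.span and rat_degree = rat_vs.dim
  by unfold_locales (simp_all add: algebra_simps of_rat_add of_rat_mult)

definition number_field :: "'a::field_char_0 set \<Rightarrow> bool" where
  "number_field K \<longleftrightarrow> is_subfield K \<and> (\<exists>B. finite B \<and> rat_span B = K)"

text \<open>The library's dimension is \<open>0\<close> for spaces without a finite basis, so
  \<open>rat_degree K = 2\<close> includes that \<open>K\<close> is finite-dimensional over the rationals.\<close>

definition real_quadratic_field :: "real set \<Rightarrow> bool" where
  "real_quadratic_field K \<longleftrightarrow> is_subfield K \<and> rat_degree K = 2"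

lemma of_rat_in_subfield:
  fixes K :: "'a::field_char_0 set"
  assumes "is_subfield K"
  shows "of_rat q \<in> K"
proof -
  have nat: "of_nat m \<in> K" for m
    using assms by (induction m) (auto simp: is_subfield_def)
  have int: "of_int i \<in> K" for i
  proof (cases i)
    case (nonneg m)
    then show ?thesis using nat[of m] by simp
  next
    case (neg m)
    have "- of_nat (Suc m) \<in> K"
      using assms nat[of "Suc m"] unfolding is_subfield_def by blast
    then show ?thesis using neg by simp
  qed
  obtain a b where q: "q = Fract a b" "b > 0"
    by (cases q) auto
  then have "(of_rat q :: 'a) = of_int a * inverse (of_int b)"
    by (simp add: of_rat_rat divide_inverse)
  moreover have "inverse (of_int b) \<in> K"
    using assms int[of b] q(2) unfolding is_subfield_def by auto
  ultimately show ?thesis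
    using assms int[of a] unfolding is_subfield_def by simp
qed

lemma real_quadratic_field_imp_number_field:
  assumes "real_quadratic_field K"
  shows "number_field K"
proof -
  have K: "is_subfield K" "rat_degree K = 2"
    using assms by (auto simp: real_quadratic_field_def)
  obtain B where B: "B \<subseteq> K" "rat_vs.independent B" "K \<subseteq> rat_span B" "card B = rat_degree K"
    using rat_vs.basis_exists[of K] by blast
  have "rat_vs.subspace K"
    using K(1) of_rat_in_subfield[OF K(1)]
    unfolding rat_vs.subspace_def is_subfield_def by blast
  then have "rat_span B = K"
    using B by (metis rat_vs.span_subspace)
  moreover have "finite B"
    using B(4) K(2) by (metis card.infinite zero_neq_numeral)
  ultimately show ?thesis
    using K(1) by (auto simp: number_field_def)
qed

text \<open>The notions below are meant for a positive integer \<open>n\<close> and a number field \<open>K\<close>,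
  given as a subfield of some field of characteristic zero.\<close>

definition congruent_triples :: "'a::field_char_0 set \<Rightarrow> nat \<Rightarrow> ('a \<times> 'a \<times> 'a) set" where
  "congruent_triples K n =
     {(a, b, c). a \<in> K \<and> b \<in> K \<and> c \<in> K \<and> a\<^sup>2 + b\<^sup>2 = c\<^sup>2 \<and> 1 / 2 * a * b = of_nat n}"

definition congruent_number :: "'a::field_char_0 set \<Rightarrow> nat \<Rightarrow> bool" where
  "congruent_number K n \<longleftrightarrow> congruent_triples K n \<noteq> {}"

definition properly_congruent :: "'a::field_char_0 set \<Rightarrow> nat \<Rightarrow> bool" where
  "properly_congruent K n \<longleftrightarrow> congruent_number K n \<and> infinite (congruent_triples K n)"

end

theory Submission
  imports Defs "HOL-Computational_Algebra.Nth_Powers" "HOL-Computational_Algebra.Polynomial"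
begin

text \<open>
  A right triangle of area \<open>n\<close> is a point on the elliptic curve \<open>y\<^sup>2 = x\<^sup>3 - n\<^sup>2 x\<close>, and
  doubling this point gives another right triangle of the same area. Starting from an integral
  triangle with an odd leg, each doubling lowers the 2-adic order of the hypotenuse by one, so the
  triangles obtained are pairwise distinct. Hence 6 and 30, the areas of \<open>(3, 4, 5)\<close> and
  \<open>(5, 12, 13)\<close>, are properly congruent over the rationals. Scaling by \<open>r = sqrt (n / m)\<close> turns a
  triangle of area \<open>m\<close> into one of area \<open>n\<close> over \<open>\<rat>(r)\<close>. As \<open>30 / 6\<close> is not a rational square,
  \<open>r\<close> is irrational for \<open>m = 6\<close> or for \<open>m = 30\<close>.
\<close>

lemma is_subfield_closed:
  assumes "is_subfield K" "x \<in> K" "y \<in> K"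
  shows "x + y \<in> K" "x - y \<in> K" "x * y \<in> K" "x / y \<in> K"
proof -
  show "x + y \<in> K" "x * y \<in> K"
    using assms by (auto simp: is_subfield_def)
  show "x - y \<in> K"
    using assms unfolding is_subfield_def by (metis diff_conv_add_uminus)
  show "x / y \<in> K"
    using assms unfolding is_subfield_def by (metis divide_inverse inverse_zero)
qed

lemma is_subfield_power:
  assumes "is_subfield K" "x \<in> K"
  shows "x ^ k \<in> K"
  using assms by (induction k) (auto simp: is_subfield_def)

lemma Rats_subset_subfield:
  assumes "is_subfield K"
  shows "\<rat> \<subseteq> K"
  using of_rat_in_subfield[OF assms] by (auto elim: Rats_cases)

lemma is_subfield_Rats: "is_subfield \<rat>"
  by (auto simp: is_subfield_def)

lemma mem_rat_span_pair_iff: "x \<in> rat_span {1, r} \<longleftrightarrow> (\<exists>p q. x = of_rat p + of_rat q * r)"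
  by (auto simp: rat_vs.span_insert algebra_simps)

lemma rat_span_pair_mult:
  assumes "r\<^sup>2 \<in> \<rat>" "x \<in> rat_span {1, r}" "y \<in> rat_span {1, r}"
  shows "x * y \<in> rat_span {1, r}"
proof -
  obtain d where r_sq: "r\<^sup>2 = of_rat d"
    using assms(1) by (rule Rats_cases)
  obtain p q p' q' where x_eq: "x = of_rat p + of_rat q * r"
    and y_eq: "y = of_rat p' + of_rat q' * r"
    using assms(2,3) unfolding mem_rat_span_pair_iff by blast
  have "x * y = of_rat p * of_rat p' + of_rat q * of_rat q' * r\<^sup>2
      + (of_rat p * of_rat q' + of_rat q * of_rat p') * r"
    unfolding x_eq y_eq by (simp add: algebra_simps power2_eq_square)
  also have "\<dots> = of_rat (p * p' + q * q' * d) + of_rat (p * q' + q * p') * r"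
    by (simp add: r_sq of_rat_add of_rat_mult)
  finally show ?thesis
    unfolding mem_rat_span_pair_iff by blast
qed

lemma rat_span_pair_inverse:
  assumes "r\<^sup>2 \<in> \<rat>" "x \<in> rat_span {1, r}"
  shows "inverse x \<in> rat_span {1, r}"
proof -
  obtain d where r_sq: "r\<^sup>2 = of_rat d"
    using assms(1) by (rule Rats_cases)
  obtain p q where x_eq: "x = of_rat p + of_rat q * r"
    using assms(2) unfolding mem_rat_span_pair_iff by blast
  define conjugate where "conjugate = of_rat p - of_rat q * r"
  show ?thesis
  proof (cases "conjugate = 0")
    case True
    then have "x = of_rat (2 * p)"
      by (simp add: x_eq conjugate_def of_rat_mult)
    then have "inverse x = of_rat (inverse (2 * p)) + of_rat 0 * r"
      by (simp only: of_rat_inverse of_rat_0 mult_zero_left add_0_right)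
    then show ?thesis
      unfolding mem_rat_span_pair_iff by blast
  next
    case False
    define N where "N = p\<^sup>2 - q\<^sup>2 * d"
    have norm_eq: "x * conjugate = of_rat N"
      by (simp add: x_eq conjugate_def N_def of_rat_diff of_rat_mult of_rat_power flip: r_sq)
        (simp add: algebra_simps power2_eq_square)
    have "inverse x = conjugate / of_rat N"
      using False by (simp add: inverse_eq_divide flip: norm_eq)
    also have "\<dots> = of_rat (p / N) + of_rat (- q / N) * r"
      by (simp add: conjugate_def of_rat_divide of_rat_minus diff_divide_distrib)
    finally show ?thesis
      unfolding mem_rat_span_pair_iff by blast
  qed
qed

lemma is_subfield_rat_span_pair:
  assumes "r\<^sup>2 \<in> \<rat>"
  shows "is_subfield (rat_span {1, r})"
  using rat_span_pair_mult[OF assms] rat_span_pair_inverse[OF assms]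
  by (simp add: is_subfield_def rat_vs.span_zero rat_vs.span_base rat_vs.span_add rat_vs.span_neg)

lemma rat_degree_rat_span_pair:
  assumes "r \<notin> \<rat>"
  shows "rat_degree (rat_span {1, r}) = 2"
proof -
  have "r \<notin> rat_span {1}"
    using assms by (auto simp: rat_vs.span_singleton)
  then have "rat_vs.independent {r, 1}"
    by (rule rat_vs.independent_insertI) simp
  then have "rat_degree (rat_span {r, 1}) = card {r, 1}"
    by (rule rat_vs.dim_span_eq_card_independent)
  moreover have "r \<noteq> 1"
    using assms by auto
  ultimately show ?thesis
    by (simp add: insert_commute)
qed

lemma real_quadratic_field_rat_span_pair:
  assumes "r\<^sup>2 \<in> \<rat>" "r \<notin> \<rat>"
  shows "real_quadratic_field (rat_span {1, r})"
  unfolding real_quadratic_field_def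
  using is_subfield_rat_span_pair[OF assms(1)] rat_degree_rat_span_pair[OF assms(2)] ..

lemma properly_congruent_iff_infinite:
  "properly_congruent K n \<longleftrightarrow> infinite (congruent_triples K n)"
  by (auto simp: properly_congruent_def congruent_number_def)

lemma properly_congruent_scale:
  fixes K L :: "'a::field_char_0 set"
  assumes "properly_congruent K m" "K \<subseteq> L" "is_subfield L"
    and "r \<in> L" "r \<noteq> 0" "of_nat m * r\<^sup>2 = of_nat n"
  shows "properly_congruent L n"
proof -
  define scale :: "'a \<times> 'a \<times> 'a \<Rightarrow> 'a \<times> 'a \<times> 'a"
    where "scale = (\<lambda>(a, b, c). (a * r, b * r, c * r))"
  have scale_in: "scale t \<in> congruent_triples L n" if "t \<in> congruent_triples K m" for t
  proof -
    obtain a b c where t_eq: "t = (a, b, c)" and abc_in: "a \<in> K" "b \<in> K" "c \<in> K"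
      and pyth: "a\<^sup>2 + b\<^sup>2 = c\<^sup>2" and area: "1 / 2 * a * b = of_nat m"
      using \<open>t \<in> congruent_triples K m\<close> by (auto simp: congruent_triples_def)
    have "(a * r)\<^sup>2 + (b * r)\<^sup>2 = (c * r)\<^sup>2"
      by (simp add: power_mult_distrib flip: pyth distrib_right)
    moreover have "1 / 2 * (a * r) * (b * r) = of_nat n"
      using assms(6) unfolding area[symmetric] by (simp add: power2_eq_square mult_ac)
    ultimately show ?thesis
      using t_eq abc_in assms(2-4) by (auto simp: congruent_triples_def scale_def is_subfield_def)
  qed
  have "inj scale"
    using assms(5) by (auto simp: inj_def scale_def)
  then have "infinite (scale ` congruent_triples K m)"
    using assms(1) by (simp add: properly_congruent_iff_infinite finite_image_iff inj_on_subset)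
  moreover have "scale ` congruent_triples K m \<subseteq> congruent_triples L n"
    using scale_in by blast
  ultimately show ?thesis
    unfolding properly_congruent_iff_infinite by (metis finite_subset)
qed

definition double_triangle :: "'a::field \<times> 'a \<times> 'a \<Rightarrow> 'a \<times> 'a \<times> 'a" where
  "double_triangle = (\<lambda>(a, b, c).
     ((a\<^sup>2 - b\<^sup>2) / (2 * c), 2 * a * b * c / (a\<^sup>2 - b\<^sup>2),
      (c ^ 4 + 4 * a\<^sup>2 * b\<^sup>2) / (2 * c * (a\<^sup>2 - b\<^sup>2))))"

lemma double_triangle_in_congruent_triples:
  assumes "is_subfield K" "(a, b, c) \<in> congruent_triples K n"
    and "c \<noteq> 0" "a\<^sup>2 \<noteq> b\<^sup>2"
  shows "double_triangle (a, b, c) \<in> congruent_triples K n"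
proof -
  define e where "e = a\<^sup>2 - b\<^sup>2"
  have "e \<noteq> 0"
    using assms(4) by (simp add: e_def)
  have in_K: "a \<in> K" "b \<in> K" "c \<in> K" "2 \<in> K" "4 \<in> K"
    using assms(2) Rats_subset_subfield[OF assms(1)] Rats_number_of
    by (auto simp: congruent_triples_def)
  have pyth: "a\<^sup>2 + b\<^sup>2 = c\<^sup>2" and area: "1 / 2 * a * b = of_nat n"
    using assms(2) by (auto simp: congruent_triples_def)
  have double: "double_triangle (a, b, c)
      = (e / (2 * c), 2 * a * b * c / e, (c ^ 4 + 4 * a\<^sup>2 * b\<^sup>2) / (2 * c * e))"
    by (simp add: double_triangle_def e_def)
  have "c ^ 4 = e\<^sup>2 + 4 * a\<^sup>2 * b\<^sup>2"
    using pyth unfolding e_def by algebra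
  then have "e ^ 4 + 16 * a\<^sup>2 * b\<^sup>2 * c ^ 4 = (c ^ 4 + 4 * a\<^sup>2 * b\<^sup>2)\<^sup>2"
    by algebra
  moreover have "(e / (2 * c))\<^sup>2 + (2 * a * b * c / e)\<^sup>2
      = (e ^ 4 + 16 * a\<^sup>2 * b\<^sup>2 * c ^ 4) / (2 * c * e)\<^sup>2"
    using \<open>e \<noteq> 0\<close> \<open>c \<noteq> 0\<close> by (simp add: field_simps power2_eq_square eval_nat_numeral)
  ultimately have "(e / (2 * c))\<^sup>2 + (2 * a * b * c / e)\<^sup>2
      = ((c ^ 4 + 4 * a\<^sup>2 * b\<^sup>2) / (2 * c * e))\<^sup>2"
    by (simp add: power_divide)
  moreover have "1 / 2 * (e / (2 * c)) * (2 * a * b * c / e) = of_nat n"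
    using \<open>e \<noteq> 0\<close> \<open>c \<noteq> 0\<close> by (simp flip: area)
  moreover have "e / (2 * c) \<in> K" "2 * a * b * c / e \<in> K"
    "(c ^ 4 + 4 * a\<^sup>2 * b\<^sup>2) / (2 * c * e) \<in> K"
    using assms(1) in_K by (auto simp: e_def intro!: is_subfield_closed is_subfield_power)
  ultimately show ?thesis
    unfolding double congruent_triples_def by blast
qed

lemma double_triangle_fractions:
  fixes a b c :: "'a::field"
  assumes "a\<^sup>2 + b\<^sup>2 = c\<^sup>2" "a = p / d" "c = s / d" "d \<noteq> 0"
    and "e = 2 * p\<^sup>2 - s\<^sup>2" "e \<noteq> 0"
  shows "(a\<^sup>2 - b\<^sup>2) / (2 * c) = e\<^sup>2 / (2 * d * s * e)"
    and "(c ^ 4 + 4 * a\<^sup>2 * b\<^sup>2) / (2 * c * (a\<^sup>2 - b\<^sup>2))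
      = (s ^ 4 + 4 * p\<^sup>2 * (s\<^sup>2 - p\<^sup>2)) / (2 * d * s * e)"
proof -
  have b_sq: "b\<^sup>2 = (s\<^sup>2 - p\<^sup>2) / d\<^sup>2"
    using assms(1-3) by (simp add: power_divide diff_divide_distrib eq_diff_eq add.commute)
  have difference: "a\<^sup>2 - b\<^sup>2 = e / d\<^sup>2"
    by (simp add: b_sq assms(2,5) power_divide flip: diff_divide_distrib)
  have numerator: "c ^ 4 + 4 * a\<^sup>2 * b\<^sup>2 = (s ^ 4 + 4 * p\<^sup>2 * (s\<^sup>2 - p\<^sup>2)) / d ^ 4"
    by (simp add: b_sq assms(2,3) power_divide add_divide_distrib flip: power_add)
  show "(a\<^sup>2 - b\<^sup>2) / (2 * c) = e\<^sup>2 / (2 * d * s * e)"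
    unfolding difference using assms(4,6) by (simp add: assms(3) power2_eq_square mult_ac)
  show "(c ^ 4 + 4 * a\<^sup>2 * b\<^sup>2) / (2 * c * (a\<^sup>2 - b\<^sup>2))
      = (s ^ 4 + 4 * p\<^sup>2 * (s\<^sup>2 - p\<^sup>2)) / (2 * d * s * e)"
    unfolding difference numerator using assms(4)
    by (simp add: assms(3) power2_eq_square eval_nat_numeral mult_ac)
qed

text \<open>The leg \<open>a\<close> and the hypotenuse \<open>c\<close> have 2-adic order \<open>- k\<close>, witnessed by fractions with the
  same denominator. The leg \<open>b\<close> enters the doubling argument only through \<open>b\<^sup>2 = c\<^sup>2 - a\<^sup>2\<close>.\<close>

definition has_dyadic_depth :: "nat \<Rightarrow> 'a::field_char_0 \<times> 'a \<times> 'a \<Rightarrow> bool" where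
  "has_dyadic_depth k = (\<lambda>(a, b, c). \<exists>p q s. odd p \<and> odd q \<and> odd s \<and>
     a = of_int p / (2 ^ k * of_int q) \<and> c = of_int s / (2 ^ k * of_int q))"

lemma has_dyadic_depthI:
  assumes "odd p" "odd q" "odd s"
    and "a = of_int p / (2 ^ k * of_int q)" "c = of_int s / (2 ^ k * of_int q)"
  shows "has_dyadic_depth k (a, b, c)"
  using assms by (auto simp: has_dyadic_depth_def)

lemma has_dyadic_depth_unique:
  fixes t :: "'a::field_char_0 \<times> 'a \<times> 'a"
  assumes "has_dyadic_depth j t" "has_dyadic_depth k t"
  shows "j = k"
proof -
  obtain a b c where t_eq: "t = (a, b, c)"
    by (cases t)
  obtain q s where depth_j: "odd q" "odd s" "c = of_int s / (2 ^ j * of_int q)"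
    using assms(1) by (auto simp: has_dyadic_depth_def t_eq)
  obtain q' s' where depth_k: "odd q'" "odd s'" "c = of_int s' / (2 ^ k * of_int q')"
    using assms(2) by (auto simp: has_dyadic_depth_def t_eq)
  have "q \<noteq> 0" "q' \<noteq> 0"
    using depth_j(1) depth_k(1) by auto
  then have "of_int (s' * q * 2 ^ j) = (of_int (s * q' * 2 ^ k) :: 'a)"
    using depth_j(3) depth_k(3) by (simp add: field_simps)
  then have "s' * q * 2 ^ j = s * q' * 2 ^ k"
    unfolding of_int_eq_iff .
  then show ?thesis
    using depth_j depth_k by (intro prime_power_cancel[of 2 "s' * q" j "s * q'" k]) auto
qed

lemma has_dyadic_depth_imp_nondegenerate:
  fixes a b c :: "'a::field_char_0"
  assumes "has_dyadic_depth k (a, b, c)" "a\<^sup>2 + b\<^sup>2 = c\<^sup>2"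
  shows "c \<noteq> 0" "a\<^sup>2 \<noteq> b\<^sup>2"
proof -
  obtain p q s where odd: "odd p" "odd q" "odd s"
    and ac_eq: "a = of_int p / (2 ^ k * of_int q)" "c = of_int s / (2 ^ k * of_int q)"
    using assms(1) by (auto simp: has_dyadic_depth_def)
  have nonzero: "q \<noteq> 0" "s \<noteq> 0"
    using odd by auto
  then show "c \<noteq> 0"
    by (simp add: ac_eq)
  show "a\<^sup>2 \<noteq> b\<^sup>2"
  proof
    assume "a\<^sup>2 = b\<^sup>2"
    then have "2 * a\<^sup>2 = c\<^sup>2"
      using assms(2) by simp
    then have "of_int (2 * p\<^sup>2) = (of_int (s\<^sup>2) :: 'a)"
      using nonzero by (simp add: ac_eq power_divide)
    then have "2 * p\<^sup>2 = s\<^sup>2"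
      unfolding of_int_eq_iff .
    then show False
      using \<open>odd s\<close> by (metis dvd_triv_left even_power)
  qed
qed

lemma has_dyadic_depth_double_triangle:
  fixes a b c :: "'a::field_char_0"
  assumes "has_dyadic_depth k (a, b, c)" "a\<^sup>2 + b\<^sup>2 = c\<^sup>2"
  shows "has_dyadic_depth (Suc k) (double_triangle (a, b, c))"
proof -
  obtain p q s where odd: "odd p" "odd q" "odd s"
    and ac_eq: "a = of_int p / (2 ^ k * of_int q)" "c = of_int s / (2 ^ k * of_int q)"
    using assms(1) by (auto simp: has_dyadic_depth_def)
  define e where "e = 2 * p\<^sup>2 - s\<^sup>2"
  define h where "h = s ^ 4 + 4 * p\<^sup>2 * (s\<^sup>2 - p\<^sup>2)"
  have "odd e" "odd h"
    using odd by (simp_all add: e_def h_def)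
  then have nonzero: "2 ^ k * of_int q \<noteq> (0 :: 'a)" "of_int e \<noteq> (0 :: 'a)"
    using odd by auto
  have of_int_e: "of_int e = (2 * (of_int p)\<^sup>2 - (of_int s)\<^sup>2 :: 'a)"
    and of_int_h: "of_int h
      = ((of_int s) ^ 4 + 4 * (of_int p)\<^sup>2 * ((of_int s)\<^sup>2 - (of_int p)\<^sup>2) :: 'a)"
    by (simp_all add: e_def h_def)
  note legs = double_triangle_fractions[OF assms(2) ac_eq nonzero(1) of_int_e nonzero(2)]
  show ?thesis
    unfolding double_triangle_def prod.case
  proof (rule has_dyadic_depthI)
    show "odd (e\<^sup>2)" "odd (q * s * e)" "odd h"
      using odd \<open>odd e\<close> \<open>odd h\<close> by simp_all
    show "(a\<^sup>2 - b\<^sup>2) / (2 * c) = of_int (e\<^sup>2) / (2 ^ Suc k * of_int (q * s * e))"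
      using legs(1) by (simp add: mult_ac)
    show "(c ^ 4 + 4 * a\<^sup>2 * b\<^sup>2) / (2 * c * (a\<^sup>2 - b\<^sup>2))
        = of_int h / (2 ^ Suc k * of_int (q * s * e))"
      using legs(2) by (simp add: of_int_h mult_ac)
  qed
qed

lemma properly_congruent_if_has_dyadic_depth:
  assumes "is_subfield K" "t \<in> congruent_triples K n" "has_dyadic_depth k t"
  shows "properly_congruent K n"
proof -
  define f where "f i = (double_triangle ^^ i) t" for i
  have f_depth: "f i \<in> congruent_triples K n \<and> has_dyadic_depth (k + i) (f i)" for i
  proof (induction i)
    case 0
    then show ?case
      using assms by (simp add: f_def)
  next
    case (Suc i)
    obtain a b c where f_i: "f i = (a, b, c)"
      by (cases "f i")
    with Suc.IH have triple: "(a, b, c) \<in> congruent_triples K n"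
      and depth: "has_dyadic_depth (k + i) (a, b, c)"
      by simp_all
    then have pyth: "a\<^sup>2 + b\<^sup>2 = c\<^sup>2"
      by (simp add: congruent_triples_def)
    have "double_triangle (a, b, c) \<in> congruent_triples K n"
      using has_dyadic_depth_imp_nondegenerate[OF depth pyth]
      by (rule double_triangle_in_congruent_triples[OF assms(1) triple])
    moreover have "f (Suc i) = double_triangle (a, b, c)"
      by (simp add: f_def flip: f_i)
    ultimately show ?case
      using has_dyadic_depth_double_triangle[OF depth pyth] by simp
  qed
  have "inj f"
    using f_depth has_dyadic_depth_unique by (metis add_left_cancel injI)
  then show ?thesis
    using f_depth unfolding properly_congruent_iff_infinite infinite_iff_countable_subset by blast
qed

lemma properly_congruent_if_odd_pythagorean_triple:
  fixes K :: "'a::field_char_0 set" and a b c n :: nat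
  assumes "is_subfield K" "odd a" "a\<^sup>2 + b\<^sup>2 = c\<^sup>2" "a * b = 2 * n"
  shows "properly_congruent K n"
proof (rule properly_congruent_if_has_dyadic_depth)
  show "(of_nat a, of_nat b, of_nat c) \<in> congruent_triples K n"
  proof -
    have "(of_nat a)\<^sup>2 + (of_nat b)\<^sup>2 = (of_nat c :: 'a)\<^sup>2"
      using assms(3) by (metis of_nat_add of_nat_power)
    moreover have "of_nat a * of_nat b = (2 * of_nat n :: 'a)"
      using assms(4) by (metis of_nat_mult of_nat_numeral)
    ultimately show ?thesis
      using Rats_subset_subfield[OF assms(1)] by (auto simp: congruent_triples_def)
  qed
  have "even b"
    using assms(2,4) by (metis dvd_triv_left even_mult_iff)
  then have "odd c"
    using assms(2,3) by (metis even_add even_power pos2)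
  then show "has_dyadic_depth 0 (of_nat a, of_nat b, of_nat c)"
    using assms(2) by (intro has_dyadic_depthI[of "int a" 1 "int c"]) simp_all
qed fact

lemma sqrt_of_nat_in_Rats_iff: "sqrt (of_nat m) \<in> \<rat> \<longleftrightarrow> is_square m"
proof
  assume "sqrt (of_nat m) \<in> \<rat>"
  then have "sqrt (of_nat m) \<in> \<int>"
    by (intro rational_algebraic_int_is_int algebraic_int_sqrt) auto
  then have "sqrt (of_nat m) \<in> \<nat>"
    by (simp add: Nats_altdef2)
  then obtain k where "sqrt (of_nat m) = of_nat k"
    by (rule Nats_cases)
  then have "of_nat m = (of_nat k :: real)\<^sup>2"
    by (metis of_nat_0_le_iff real_sqrt_pow2)
  then have "m = k\<^sup>2"
    by (simp flip: of_nat_power)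
  then show "is_square m"
    by simp
qed (auto elim!: is_nth_powerE)

lemma ex_real_quadratic_field_properly_congruent:
  assumes "properly_congruent (\<rat> :: real set) m" "sqrt (real n / real m) \<notin> \<rat>"
  shows "\<exists>K :: real set. real_quadratic_field K \<and> properly_congruent K n"
proof -
  define r where "r = sqrt (real n / real m)"
  have "r \<noteq> 0" "m \<noteq> 0"
    using assms(2) by (auto simp: r_def intro: ccontr)
  have r_sq: "r\<^sup>2 = real n / real m"
    by (simp add: r_def)
  have field: "real_quadratic_field (rat_span {1, r})"
    using assms(2) by (intro real_quadratic_field_rat_span_pair) (simp_all add: r_sq flip: r_def)
  then have subfield: "is_subfield (rat_span {1, r})"
    by (simp add: real_quadratic_field_def)
  have "properly_congruent (rat_span {1, r}) n"
  proof (rule properly_congruent_scale[OF assms(1) Rats_subset_subfield[OF subfield] subfield])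
    show "r \<in> rat_span {1, r}"
      by (simp add: rat_vs.span_base)
    show "real m * r\<^sup>2 = real n"
      using \<open>m \<noteq> 0\<close> by (simp add: r_sq)
  qed fact
  with field show ?thesis
    by blast
qed

theorem theorem1:
  fixes n :: nat
  assumes "n > 0"
  shows "\<exists>K :: real set. real_quadratic_field K \<and> properly_congruent K n"
proof -
  have six: "properly_congruent (\<rat> :: real set) 6"
    by (rule properly_congruent_if_odd_pythagorean_triple[where a = 3 and b = 4 and c = 5])
      (simp_all add: is_subfield_Rats)
  have thirty: "properly_congruent (\<rat> :: real set) 30"
    by (rule properly_congruent_if_odd_pythagorean_triple[where a = 5 and b = 12 and c = 13])
      (simp_all add: is_subfield_Rats)
  have "sqrt (real n / real 6) \<notin> \<rat> \<or> sqrt (real n / real 30) \<notin> \<rat>"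
  proof (rule ccontr)
    assume "\<not> ?thesis"
    then have "sqrt (real n / real 6) / sqrt (real n / real 30) \<in> \<rat>"
      by (blast intro: Rats_divide)
    also have "sqrt (real n / real 6) / sqrt (real n / real 30) = sqrt (real 5)"
      using assms by (simp flip: real_sqrt_divide)
    finally have "is_square (5 :: nat)"
      by (simp only: sqrt_of_nat_in_Rats_iff)
    then show False
      using is_nth_power_prime_power_nat_iff[of 5 2 1] by simp
  qed
  then show ?thesis
    using six thirty ex_real_quadratic_field_properly_congruent by blast
qed

end
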